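(* Let $C_{f,g}(N,\cdot)$ be a Two-Seasons (T-S) Correlation with $g$ not identically zero, and let $U_N=\prod_{2<p\le N}p$ (product over primes). Then $$C_{f,g}(N,1)=C_{f,g}(N,U_N+1)\qquad\text{and}\qquad C_{f,g}(N,2)=C_{f,g}(N,U_N+2).$$
   Context: $\mathbb{N}=\{1,2,3,\dots\}$; $p$ always denotes a prime. For $f,g:\mathbb{N}\to\mathbb{C}$ and $N\in\mathbb{N}$ the Correlation of $f$ and $g$ with length $N$ and shift $a\in\mathbb{N}$ is $C_{f,g}(N,a)=\sum_{n\le N}f(n)g(n+a)$ (sum over $1\le n\le N$). The Eratosthenes Transform of $g:\mathbb{N}\to\mathbb{C}$ is $g'(d)=\sum_{t\mid d}g(t)\mu(d/t)$, with $\mu$ the Möbius function, so $g(n)=\sum_{d\mid n}g'(d)$. $C_{f,g}(N,\cdot)$ is called a Two-Seasons (T-S) Correlation if all the following Axioms hold: (0) $g'$ is supported in $[1,Q]$ with $Q\le N$, and the Correlation is Fair, meaning that $f$ and $g$ (their values and supports) do not depend on the shift $a$ (they are fixed functions, possibly depending on $N$); (1) $g'$ is supported on square-free integers; (2) $f$ is supported on prime numbers; (3) $g'$ is supported on odd integers and $f$ is supported on odd integers; (4) in (0) one has $Q=N\ge 9$, and neither $N$ nor $N-1$ is prime. *)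

theory Defs
  imports Complex_Main "HOL-Computational_Algebra.Squarefree"
begin

(* Arithmetic functions on the positive integers are functions of type
   "nat \<Rightarrow> complex" whose value at 0 is never inspected. *)

definition moebius :: "nat \<Rightarrow> complex" where
  "moebius n = (if squarefree n then (- 1) ^ card (prime_factors n) else 0)"

definition eratosthenes_transform :: "(nat \<Rightarrow> complex) \<Rightarrow> nat \<Rightarrow> complex" where
  "eratosthenes_transform g d = (\<Sum>t | t dvd d. g t * moebius (d div t))"

definition correlation ::
    "(nat \<Rightarrow> complex) \<Rightarrow> (nat \<Rightarrow> complex) \<Rightarrow> nat \<Rightarrow> nat \<Rightarrow> complex" where
  "correlation f g N a = (\<Sum>n=1..N. f n * g (n + a))"

definition arith_support :: "(nat \<Rightarrow> complex) \<Rightarrow> nat set" where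
  "arith_support h = {n. 1 \<le> n \<and> h n \<noteq> 0}"

(* The conjuncts of the body follow Axioms (0)-(4) in order. Fairness, in Axiom (0),
   is carried by the types: f and g do not take the shift as an argument, and the
   predicate does not mention it. They may depend on N, which is fixed. *)
definition two_seasons ::
    "(nat \<Rightarrow> complex) \<Rightarrow> (nat \<Rightarrow> complex) \<Rightarrow> nat \<Rightarrow> bool" where
  "two_seasons f g N \<longleftrightarrow>
     (\<exists>Q. (arith_support (eratosthenes_transform g) \<subseteq> {1..Q} \<and> Q \<le> N) \<and>
          (\<forall>d \<in> arith_support (eratosthenes_transform g). squarefree d) \<and>
          (\<forall>n \<in> arith_support f. prime n) \<and>
          ((\<forall>d \<in> arith_support (eratosthenes_transform g). odd d) \<and>
           (\<forall>n \<in> arith_support f. odd n)) \<and>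
          (Q = N \<and> 9 \<le> N \<and> \<not> prime N \<and> \<not> prime (N - 1)))"

definition odd_primorial :: "nat \<Rightarrow> nat" where
  "odd_primorial N = (\<Prod>p | prime p \<and> 2 < p \<and> p \<le> N. p)"

end

theory Submission
  imports Defs
begin

text \<open>
  By Moebius inversion, \<open>g n\<close> is the sum of the Eratosthenes transform of \<open>g\<close> over the
  divisors of \<open>n\<close> (\<open>moebius_inversion\<close>). Only divisors in the support of the transform
  contribute, and these are odd, squarefree and at most \<open>N\<close>. Such a number is a product of
  distinct odd primes up to \<open>N\<close>, so it divides the odd primorial \<open>U\<close> of \<open>N\<close>
  (\<open>odd_squarefree_dvd_odd_primorial\<close>). A divisor of \<open>U\<close> divides \<open>n\<close> exactly when it
  divides \<open>n + U\<close>, so \<open>g\<close> has period \<open>U\<close> on the positive integers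
  (\<open>periodic_if_transform_support_dvd\<close>). The correlations at the shifts \<open>a\<close> and
  \<open>U + a\<close> therefore agree term by term, for every \<open>a\<close>, in particular for 1 and 2.
\<close>

lemma moebius_prime_mult:
  assumes "prime p" "\<not> p dvd d" "d > 0"
  shows "moebius (p * d) = - moebius d"
proof -
  have cop: "coprime p d"
    using assms by (simp add: prime_imp_coprime)
  have "prime_factors (p * d) = insert p (prime_factors d)"
    using assms by (simp add: prime_factors_product prime_prime_factors)
  moreover have "p \<notin> prime_factors d"
    using assms by auto
  ultimately have "card (prime_factors (p * d)) = Suc (card (prime_factors d))"
    by simp
  moreover have "squarefree (p * d) \<longleftrightarrow> squarefree d"
    using cop assms(1) by (auto simp: squarefree_mult_coprime squarefree_prime dest: squarefree_multD)
  ultimately show ?thesis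
    by (simp add: moebius_def)
qed

text \<open>
  For a prime \<open>p\<close> dividing \<open>n\<close>, multiplication by \<open>p\<close> pairs the squarefree divisors of
  \<open>n\<close> prime to \<open>p\<close> with those divisible by \<open>p\<close>, and the two terms of each pair cancel.
\<close>

lemma sum_moebius_divisors:
  fixes n :: nat
  assumes "n > 1"
  shows "(\<Sum>d | d dvd n. moebius d) = 0"
proof -
  obtain p where p: "prime p" "p dvd n"
    using assms prime_factor_nat[of n] by auto
  have pos: "d > 0" if "d dvd n" for d
    using that assms by (auto intro!: Nat.gr0I)
  define A where "A = {d. d dvd n \<and> squarefree d \<and> \<not> p dvd d}"
  define B where "B = {d. d dvd n \<and> squarefree d \<and> p dvd d}"
  have fin: "finite {d. d dvd n}"
    using assms by (intro finite_divisors_nat) auto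
  have "B = (*) p ` A"
  proof
    show "B \<subseteq> (*) p ` A"
    proof
      fix d assume "d \<in> B"
      then have d: "d dvd n" "squarefree d" "p dvd d"
        by (auto simp: B_def)
      then obtain e where e: "d = p * e"
        by blast
      have "\<not> p dvd e"
      proof
        assume "p dvd e"
        then have "p\<^sup>2 dvd d"
          by (auto simp: e power2_eq_square)
        with d(2) p(1) show False
          by (auto simp: squarefree_def)
      qed
      moreover have "squarefree e"
        using d(2) by (auto simp: e dest: squarefree_multD)
      ultimately have "e \<in> A"
        using d(1) by (auto simp: A_def e dest: dvd_mult_right)
      then show "d \<in> (*) p ` A"
        by (auto simp: e)
    qed
    show "(*) p ` A \<subseteq> B"
      using p by (auto simp: A_def B_def prime_imp_coprime divides_mult squarefree_mult_coprime squarefree_prime)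
  qed
  then have "(\<Sum>d\<in>B. moebius d) = (\<Sum>d\<in>A. moebius (p * d))"
    using p(1) by (simp add: sum.reindex inj_on_def)
  also have "\<dots> = (\<Sum>d\<in>A. - moebius d)"
    by (intro sum.cong refl moebius_prime_mult) (auto simp: A_def p pos)
  finally have cancel: "(\<Sum>d\<in>B. moebius d) = - (\<Sum>d\<in>A. moebius d)"
    by (simp add: sum_negf)
  have "(\<Sum>d | d dvd n. moebius d) = (\<Sum>d\<in>A \<union> B. moebius d)"
    \<comment> \<open>the divisors that are not squarefree contribute 0\<close>
    by (rule sum.mono_neutral_right[OF fin]) (auto simp: A_def B_def moebius_def)
  also have "\<dots> = (\<Sum>d\<in>A. moebius d) + (\<Sum>d\<in>B. moebius d)"
    by (rule sum.union_disjoint) (auto simp: A_def B_def intro: finite_subset[OF _ fin])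
  finally show ?thesis
    by (simp add: cancel)
qed

text \<open>
  After exchanging the sums over \<open>d\<close> and over \<open>t dvd d\<close>, the coefficient of \<open>g t\<close> is the
  sum of the Moebius function over the divisors of \<open>n div t\<close>, which vanishes unless
  \<open>t = n\<close>.
\<close>

lemma moebius_inversion:
  assumes "n > 0"
  shows "(\<Sum>d | d dvd n. eratosthenes_transform g d) = g n"
proof -
  have fin: "finite {d. d dvd m}" if "m > 0" for m :: nat
    using that by (rule finite_divisors_nat)
  have pos: "d > 0" if "d dvd n" for d
    using that assms by (auto intro!: Nat.gr0I)
  have inner: "(\<Sum>d | d dvd n \<and> t dvd d. g t * moebius (d div t)) = (if t = n then g n else 0)"
    if t: "t dvd n" for t
  proof -
    have "(\<Sum>d | d dvd n \<and> t dvd d. g t * moebius (d div t)) =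
          (\<Sum>e | e dvd n div t. g t * moebius e)"
      by (rule sum.reindex_bij_witness[of _ "\<lambda>e. t * e" "\<lambda>d. d div t"])
         (use t pos[OF t] in \<open>auto simp: div_dvd_div dvd_div_iff_mult mult.commute[of _ t]\<close>)
    also have "\<dots> = g t * (\<Sum>e | e dvd n div t. moebius e)"
      by (simp add: sum_distrib_left)
    also have "\<dots> = (if t = n then g n else 0)"
    proof (cases "t = n")
      case True
      with assms show ?thesis by (simp add: moebius_def)
    next
      case False
      from t obtain k where k: "n = t * k" by blast
      with False assms have "k > 1" by (cases k) auto
      then have "(\<Sum>e | e dvd n div t. moebius e) = 0"
        using sum_moebius_divisors[of k] pos[OF t] k by simp
      with False show ?thesis by simp
    qed
    finally show ?thesis .
  qed
  have "(\<Sum>d | d dvd n. eratosthenes_transform g d) =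
        (\<Sum>d | d dvd n. \<Sum>t | t dvd n \<and> t dvd d. g t * moebius (d div t))"
    unfolding eratosthenes_transform_def
    by (intro sum.cong refl) (auto intro: dvd_trans)
  also have "\<dots> = (\<Sum>t | t dvd n. \<Sum>d | d dvd n \<and> t dvd d. g t * moebius (d div t))"
    using sum.swap_restrict[OF fin[OF assms] fin[OF assms],
        of "\<lambda>d t. g t * moebius (d div t)" "\<lambda>d t. t dvd d"]
    by simp
  also have "\<dots> = (\<Sum>t | t dvd n. if t = n then g n else 0)"
    by (intro sum.cong refl) (use inner in auto)
  also have "\<dots> = g n"
    using fin[OF assms] by simp
  finally show ?thesis .
qed

lemma odd_squarefree_dvd_odd_primorial:
  assumes "odd d" "squarefree d" "1 \<le> d" "d \<le> N"
  shows "d dvd odd_primorial N"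
proof -
  have "d = (\<Prod>p\<in>prime_factors d. p ^ multiplicity p d)"
    using assms(3) by (intro prime_factorization_nat) simp
  also have "\<dots> = (\<Prod>p\<in>prime_factors d. p)"
    using assms(2,3) by (intro prod.cong refl) (simp add: squarefree_factorial_semiring')
  also have "\<dots> dvd (\<Prod>p | prime p \<and> 2 < p \<and> p \<le> N. p)"
  proof (rule prod_dvd_prod_subset)
    show "prime_factors d \<subseteq> {p. prime p \<and> 2 < p \<and> p \<le> N}"
    proof
      fix p assume "p \<in> prime_factors d"
      then have p: "prime p" "p dvd d" by auto
      have "p \<noteq> 2" using p assms by auto
      moreover have "p \<ge> 2" using p prime_ge_2_nat by blast
      moreover have "p \<le> N" using p assms dvd_imp_le[of p d] by linarith
      ultimately show "p \<in> {p. prime p \<and> 2 < p \<and> p \<le> N}"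
        using p by auto
    qed
  qed auto
  finally show ?thesis by (simp add: odd_primorial_def)
qed

text \<open>
  The divisor sums for \<open>n\<close> and for \<open>n + U\<close> become the same sum once they are restricted to
  divisors of \<open>U\<close>.
\<close>

lemma periodic_if_transform_support_dvd:
  assumes supp: "\<forall>d \<in> arith_support (eratosthenes_transform g). d dvd U"
    and "n > 0"
  shows "g (n + U) = g n"
proof -
  have fin: "finite {d. d dvd m}" if "m > 0" for m :: nat
    using that by (rule finite_divisors_nat)
  have restrict: "g m = (\<Sum>d | d dvd m \<and> d dvd U. eratosthenes_transform g d)" if "m > 0" for m
  proof -
    have "g m = (\<Sum>d | d dvd m. eratosthenes_transform g d)"
      using moebius_inversion[OF that] by simp
    also have "\<dots> = (\<Sum>d | d dvd m \<and> d dvd U. eratosthenes_transform g d)"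
    proof (rule sum.mono_neutral_right[OF fin[OF that]])
      show "\<forall>d\<in>{d. d dvd m} - {d. d dvd m \<and> d dvd U}. eratosthenes_transform g d = 0"
      proof
        fix d assume d: "d \<in> {d. d dvd m} - {d. d dvd m \<and> d dvd U}"
        with that have "1 \<le> d" by (cases d) auto
        with d supp show "eratosthenes_transform g d = 0"
          by (auto simp: arith_support_def)
      qed
    qed auto
    finally show ?thesis .
  qed
  have "d dvd n + U \<and> d dvd U \<longleftrightarrow> d dvd n \<and> d dvd U" for d
    by (auto simp: dvd_add_left_iff)
  with restrict[of n] restrict[of "n + U"] assms(2) show ?thesis
    by simp
qed

theorem theorem5p2:
  fixes f g :: "nat \<Rightarrow> complex" and N :: nat
  assumes "two_seasons f g N"
    and "\<exists>n\<ge>1. g n \<noteq> 0"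
  shows "correlation f g N 1 = correlation f g N (odd_primorial N + 1) \<and>
         correlation f g N 2 = correlation f g N (odd_primorial N + 2)"
proof -
  have "\<forall>d \<in> arith_support (eratosthenes_transform g). d dvd odd_primorial N"
  proof
    fix d assume d: "d \<in> arith_support (eratosthenes_transform g)"
    have "arith_support (eratosthenes_transform g) \<subseteq> {1..N}"
      using assms(1) unfolding two_seasons_def by blast
    with d have "1 \<le> d" "d \<le> N"
      by auto
    moreover have "odd d" "squarefree d"
      using assms(1) d unfolding two_seasons_def by blast+
    ultimately show "d dvd odd_primorial N"
      by (intro odd_squarefree_dvd_odd_primorial)
  qed
  then have g: "g (n + odd_primorial N) = g n" if "n > 0" for n
    using that by (rule periodic_if_transform_support_dvd)
  have "correlation f g N (odd_primorial N + a) = correlation f g N a" for a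
    unfolding correlation_def
  proof (intro sum.cong refl)
    fix n assume "n \<in> {1..N}"
    then show "f n * g (n + (odd_primorial N + a)) = f n * g (n + a)"
      using g[of "n + a"] by (simp add: ac_simps)
  qed
  then show ?thesis by metis
qed

end
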